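(* Let $R$ be a unital commutative ring. If $N=p_1^{e_1}\cdots p_l^{e_l}$, where $l\in\mathbb N$, $p_1,\ldots,p_l$ are distinct primes, and $e_1,\ldots,e_l$ are natural numbers, then for each $x,y\in R$ the following congruence holds: $$(x+y)^N\equiv\sum_{s=1}^{l}\ \sum_{\substack{\{i_1,\ldots,i_s\}\subseteq\{1,\ldots,l\}\\ \{j_1,\ldots,j_{l-s}\}=\{1,\ldots,l\}\setminus\{i_1,\ldots,i_s\}}}(-1)^{s+1}\Bigl(x^{p_{i_1}^{e_{i_1}}\cdots p_{i_s}^{e_{i_s}}}+y^{p_{i_1}^{e_{i_1}}\cdots p_{i_s}^{e_{i_s}}}\Bigr)^{p_{j_1}^{e_{j_1}}\cdots p_{j_{l-s}}^{e_{j_{l-s}}}}\pmod{p_1\cdots p_l}.$$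
   Context: $\mathbb N$ is the set of positive integers. For $u,v\in R$ and $n\in\mathbb N$, $u\equiv v\pmod n$ means $u-v\in nR$. The inner sum runs over all $s$-element subsets $\{i_1,\ldots,i_s\}$ of $\{1,\ldots,l\}$; an empty product in an exponent is $1$. *)

theory Defs
  imports "HOL-Algebra.Ring" "HOL-Computational_Algebra.Primes"
begin

(* A locale-style ring rather than the class comm_ring_1, which excludes the zero ring.
   Here [n] \<cdot> r is the n-fold sum of r, so the set on the right is nR. *)
definition cong_mod_multiples ::
  "('a, 'm) ring_scheme \<Rightarrow> nat \<Rightarrow> 'a \<Rightarrow> 'a \<Rightarrow> bool" where
  "cong_mod_multiples R n u v \<longleftrightarrow>
     u \<ominus>\<^bsub>R\<^esub> v \<in> {[n] \<cdot>\<^bsub>R\<^esub> r | r. r \<in> carrier R}"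

end

theory Submission
  imports Defs "HOL-Algebra.Ideal"
begin

text \<open>
  Put \<open>F I = (x\<^bsup>n(I)\<^esup> + y\<^bsup>n(I)\<^esup>)\<^bsup>n(I')\<^esup>\<close>, where \<open>n(I)\<close> is the product of the prime powers
  indexed by \<open>I\<close> and \<open>I'\<close> is the complement of \<open>I\<close>. The claim says that the alternating sum of
  \<open>F I\<close> over all index sets \<open>I\<close>, the empty one included, lies in \<open>p\<^sub>1\<cdots>p\<^sub>l R\<close>. For each \<open>k\<close> the
  Frobenius congruence modulo \<open>p\<^sub>k\<close> gives \<open>F I \<equiv> F (I \<union> {k})\<close> whenever \<open>k \<notin> I\<close>, so the sum
  cancels in pairs modulo \<open>p\<^sub>k\<close>. The ideals \<open>p\<^sub>k R\<close> are combined by Bezout's identity.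
\<close>

section \<open>Congruences modulo an ideal\<close>

lemma (in ideal) finsum_mem:
  assumes "\<And>i. i \<in> A \<Longrightarrow> f i \<in> I"
  shows "finsum R f A \<in> I"
  using assms
proof (induction A rule: infinite_finite_induct)
  case (insert a A)
  then have "f \<in> A \<rightarrow> carrier R" "f a \<in> carrier R"
    using Icarr by auto
  with insert show ?case
    by (simp add: finsum_insert)
qed simp_all

lemma (in ideal) int_add_pow_mem:
  assumes "u \<in> I"
  shows "[(k :: int)] \<cdot> u \<in> I"
proof -
  have "[k] \<cdot> u = u \<otimes> [k] \<cdot> \<one>"
    using assms Icarr by (simp add: add_pow_rdistr_int)
  then show ?thesis
    using assms I_r_closed by simp
qed

text \<open>Induction via \<open>u^(n+1) - v^(n+1) = u^n (u - v) + (u^n - v^n) v\<close>. This lets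
  a congruence be raised to the outer exponents later on.\<close>

lemma (in ideal) pow_minus_pow_mem:
  assumes "u \<in> carrier R" "v \<in> carrier R" "u \<ominus> v \<in> I"
  shows "u [^] (n :: nat) \<ominus> v [^] n \<in> I"
proof (induction n)
  case (Suc n)
  have "a \<otimes> u \<ominus> b \<otimes> v = a \<otimes> (u \<ominus> v) \<oplus> (a \<ominus> b) \<otimes> v"
    if "a \<in> carrier R" "b \<in> carrier R" for a b
    using assms(1,2) that
    by (simp add: a_minus_def r_distr l_distr r_minus l_minus a_ac r_neg1 r_neg2)
  from this[of "u [^] n" "v [^] n"] show ?case
    using assms Suc by (simp add: I_l_closed I_r_closed)
qed (simp add: a_minus_def r_neg)

lemma (in ideal) minus_mem_trans:
  assumes "u \<in> carrier R" "v \<in> carrier R" "w \<in> carrier R" "u \<ominus> v \<in> I" "v \<ominus> w \<in> I"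
  shows "u \<ominus> w \<in> I"
proof -
  have "u \<ominus> w = (u \<ominus> v) \<oplus> (v \<ominus> w)"
    using assms(1-3) by (simp add: a_minus_def a_ac r_neg1 r_neg2)
  then show ?thesis
    using assms(4,5) by simp
qed

text \<open>The pairing argument for an arbitrary \<open>F\<close>: \<open>S\<close> and
  \<open>insert k S\<close> carry opposite signs, so together they contribute an integer multiple of
  a difference covered by \<open>step\<close>.\<close>

lemma (in ideal) alternating_sum_mem:
  assumes "finite A" "k \<in> A"
    and closed: "\<And>S. S \<subseteq> A \<Longrightarrow> F S \<in> carrier R"
    and step: "\<And>S. S \<subseteq> A - {k} \<Longrightarrow> F S \<ominus> F (insert k S) \<in> I"
  shows "(\<Oplus>S\<in>Pow A. [((-1 :: int) ^ card S)] \<cdot> F S) \<in> I"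
proof -
  define B where "B = A - {k}"
  define G where "G S = [((-1 :: int) ^ card S)] \<cdot> F S" for S
  have B: "finite B" "k \<notin> B" "A = insert k B" "B \<subseteq> A"
    using assms by (auto simp: B_def)
  have G: "G S \<in> carrier R" if "S \<subseteq> A" for S
    using closed[OF that] by (simp add: G_def)
  have ins: "insert k S \<subseteq> A" if "S \<subseteq> B" for S
    using that B by auto
  have inj: "inj_on (insert k) (Pow B)"
    using B(2) by (auto simp: inj_on_def)
  \<comment> \<open>\<open>Pow A\<close> splits into the sets avoiding \<open>k\<close> and those
    containing it; the latter are reindexed by \<open>insert k\<close>, which is injective on
    \<open>Pow B\<close>.\<close>
  have "finsum R G (Pow A) = finsum R G (Pow B) \<oplus> finsum R G (insert k ` Pow B)"
    unfolding B(3) Pow_insert using B G ins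
    by (intro finsum_Un_disjoint) (auto simp: subset_insertI2)
  also have "\<dots> = finsum R G (Pow B) \<oplus> (\<Oplus>S\<in>Pow B. G (insert k S))"
    using inj G ins by (subst finsum_reindex) (auto simp: Pi_def)
  also have "\<dots> = (\<Oplus>S\<in>Pow B. G S \<oplus> G (insert k S))"
    using G ins B(4) by (intro finsum_addf [symmetric]) (auto simp: Pi_def)
  also have "\<dots> \<in> I"
  proof (rule finsum_mem)
    fix S assume "S \<in> Pow B"
    then have S: "S \<subseteq> B" "S \<subseteq> A" "finite S" "k \<notin> S"
      using B finite_subset by auto
    \<comment> \<open>The extra sign is moved from the coefficient onto
      \<open>F (insert k S)\<close>, so that both terms share the factor
      \<open>(-1) ^ card S\<close>.\<close>
    have "G (insert k S) = [((-1 :: int) ^ card S)] \<cdot> (\<ominus> F (insert k S))"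
      using S closed[OF ins[OF S(1)]] by (simp add: G_def add.int_pow_neg add.int_pow_inv)
    then have "G S \<oplus> G (insert k S) = [((-1 :: int) ^ card S)] \<cdot> (F S \<ominus> F (insert k S))"
      using closed[OF S(2)] closed[OF ins[OF S(1)]]
      by (simp add: G_def a_minus_def add.int_pow_distrib)
    then show "G S \<oplus> G (insert k S) \<in> I"
      using step S(1) by (simp add: B_def int_add_pow_mem)
  qed
  finally show ?thesis
    by (simp add: G_def [abs_def])
qed

section \<open>The ideals \<open>nR\<close> and their intersections for coprime moduli\<close>

context cring
begin

definition multiples :: "nat \<Rightarrow> 'a set" where
  "multiples n = {[n] \<cdot> r | r. r \<in> carrier R}"

text \<open>Since \<open>n r = r (n 1)\<close>, this is the principal ideal generated by the image
  of \<open>n\<close> in \<open>R\<close>.\<close>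

lemma multiples_ideal: "ideal (multiples n) R"
proof -
  have "multiples n = PIdl ([n] \<cdot> \<one>)"
    unfolding cgenideal_def multiples_def by (auto simp: add_pow_rdistr) (metis add_pow_rdistr one_closed r_one)
  then show ?thesis
    by (simp add: cgenideal_ideal)
qed

lemma dvd_imp_mem_multiples:
  assumes "n dvd k" "r \<in> carrier R"
  shows "[k] \<cdot> r \<in> multiples n"
proof -
  obtain m where "k = n * m"
    using assms(1) by blast
  then have "[k] \<cdot> r = [n] \<cdot> ([m] \<cdot> r)"
    using assms(2) by (simp add: add.nat_pow_pow mult.commute)
  then show ?thesis
    using assms(2) by (auto simp: multiples_def)
qed

text \<open>With \<open>m a - n b = 1\<close>, write \<open>u = (m a) u - (n b) u\<close>. Putting
  \<open>u = n s\<close> into the first term and \<open>u = m r\<close> into the second turns both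
  into multiples of \<open>m n\<close>.\<close>

lemma multiples_coprime:
  assumes "coprime m n" "u \<in> multiples m" "u \<in> multiples n"
  shows "u \<in> multiples (m * n)"
proof (cases "n = 1")
  case False
  interpret ideal "multiples (m * n)" R
    by (rule multiples_ideal)
  \<comment> \<open>With natural coefficients this form of Bezout's identity needs
    \<open>n \<noteq> 1\<close>: it fails for \<open>m = 0\<close>, \<open>n = 1\<close>.\<close>
  obtain a b where ab: "m * a = n * b + 1"
    using coprime_bezout_strong[OF assms(1) False] by blast
  obtain r s where r: "r \<in> carrier R" "u = [m] \<cdot> r" and s: "s \<in> carrier R" "u = [n] \<cdot> s"
    using assms(2,3) unfolding multiples_def by blast
  have u: "u \<in> carrier R"
    unfolding r(2) using r(1) by (rule add.nat_pow_closed)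
  have "[(m * a)] \<cdot> u = [(n * (m * a))] \<cdot> s"
    unfolding s(2) using s(1) by (rule add.nat_pow_pow)
  moreover have "[(n * (m * a))] \<cdot> s \<in> multiples (m * n)"
    by (rule dvd_imp_mem_multiples) (simp_all add: s(1))
  moreover have "[(n * b)] \<cdot> u = [(m * (n * b))] \<cdot> r"
    unfolding r(2) using r(1) by (rule add.nat_pow_pow)
  moreover have "[(m * (n * b))] \<cdot> r \<in> multiples (m * n)"
    by (rule dvd_imp_mem_multiples) (simp_all add: r(1))
  ultimately have "[(m * a)] \<cdot> u \<ominus> [(n * b)] \<cdot> u \<in> multiples (m * n)"
    by (simp add: a_minus_def)
  moreover have "[(m * a)] \<cdot> u = [(n * b)] \<cdot> u \<oplus> u"
    using u by (simp add: ab)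
  then have "[(m * a)] \<cdot> u \<ominus> [(n * b)] \<cdot> u = u"
    using u by (simp add: a_minus_def a_ac r_neg r_neg1 r_neg2)
  ultimately show ?thesis
    by simp
qed (use assms in simp)

lemma multiples_prod:
  assumes "finite A" "u \<in> carrier R"
    and "\<And>i. i \<in> A \<Longrightarrow> u \<in> multiples (q i)"
    and "\<And>i j. i \<in> A \<Longrightarrow> j \<in> A \<Longrightarrow> i \<noteq> j \<Longrightarrow> coprime (q i) (q j)"
  shows "u \<in> multiples (\<Prod>i\<in>A. q i)"
  using assms
proof (induction A rule: finite_induct)
  case (insert a A)
  have "coprime (q a) (\<Prod>i\<in>A. q i)"
    using insert by (intro prod_coprime_right) auto
  then have "u \<in> multiples (q a * (\<Prod>i\<in>A. q i))"
    by (rule multiples_coprime) (use insert in auto)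
  then show ?case
    using insert by simp
qed (use dvd_imp_mem_multiples[of 1 1 u] in simp)

section \<open>The binomial theorem and the Frobenius congruence\<close>

lemma binomial:
  assumes x: "x \<in> carrier R" and y: "y \<in> carrier R"
  shows "(x \<oplus> y) [^] n = (\<Oplus>k\<in>{..n}. [(n choose k)] \<cdot> (x [^] k \<otimes> y [^] (n - k)))"
proof (induction n)
  case (Suc n)
  \<comment> \<open>\<open>t\<close> and \<open>b\<close> are the monomials for the exponents
    \<open>Suc n\<close> and \<open>n\<close>. Multiplying \<open>b k\<close> by \<open>x\<close>
    shifts the index, multiplying it by \<open>y\<close> does not; Pascal's rule then merges the two
    sums.\<close>
  define t where "t k = x [^] k \<otimes> y [^] (Suc n - k)" for k
  define b where "b k = x [^] k \<otimes> y [^] (n - k)" for k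
  have t [simp]: "t k \<in> carrier R" and b [simp]: "b k \<in> carrier R" for k
    using x y by (simp_all add: t_def b_def)
  have bx: "b k \<otimes> x = t (Suc k)" for k
    using x y by (simp add: t_def b_def m_ac)
  have by': "b k \<otimes> y = t k" if "k \<le> n" for k
    using x y that by (simp add: t_def b_def m_ac Suc_diff_le)
  have "(x \<oplus> y) [^] Suc n = (\<Oplus>k\<in>{..n}. [(n choose k)] \<cdot> b k) \<otimes> (x \<oplus> y)"
    using Suc by (simp add: b_def)
  also have "\<dots> = (\<Oplus>k\<in>{..n}. [(n choose k)] \<cdot> b k \<otimes> x) \<oplus> (\<Oplus>k\<in>{..n}. [(n choose k)] \<cdot> b k \<otimes> y)"
    using x y by (simp add: r_distr finsum_ldistr Pi_def)
  also have "(\<Oplus>k\<in>{..n}. [(n choose k)] \<cdot> b k \<otimes> x) = (\<Oplus>k\<in>{..n}. [(n choose k)] \<cdot> t (Suc k))"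
    using x by (intro finsum_cong') (auto simp: add_pow_ldistr bx)
  also have "(\<Oplus>k\<in>{..n}. [(n choose k)] \<cdot> b k \<otimes> y) = (\<Oplus>k\<in>{..n}. [(n choose k)] \<cdot> t k)"
    using y by (intro finsum_cong') (auto simp: add_pow_ldistr by')
  \<comment> \<open>The added top term has coefficient \<open>n choose Suc n = 0\<close>. Splitting
    off \<open>k = 0\<close> afterwards aligns this sum with the shifted one.\<close>
  also have "\<dots> = (\<Oplus>k\<in>{..Suc n}. [(n choose k)] \<cdot> t k)"
    by (subst finsum_Suc) (auto simp: binomial_eq_0)
  also have "\<dots> = (\<Oplus>k\<in>{..n}. [(n choose Suc k)] \<cdot> t (Suc k)) \<oplus> t 0"
    by (subst finsum_Suc2) auto
  also have "(\<Oplus>k\<in>{..n}. [(n choose k)] \<cdot> t (Suc k)) \<oplus> \<dots> =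
      (\<Oplus>k\<in>{..n}. [(n choose k)] \<cdot> t (Suc k) \<oplus> [(n choose Suc k)] \<cdot> t (Suc k)) \<oplus> t 0"
    by (simp add: a_assoc Pi_def)
  also have "\<dots> = (\<Oplus>k\<in>{..n}. [(Suc n choose Suc k)] \<cdot> t (Suc k)) \<oplus> [(Suc n choose 0)] \<cdot> t 0"
    by (simp add: add.nat_pow_mult)
  also have "\<dots> = (\<Oplus>k\<in>{..Suc n}. [(Suc n choose k)] \<cdot> t k)"
    by (rule finsum_Suc2 [symmetric]) auto
  finally show ?case
    by (simp add: t_def)
qed simp

text \<open>The prime \<open>p\<close> divides \<open>p choose k\<close> for
  \<open>0 < k < p\<close>, so only the two outer binomial terms survive modulo
  \<open>p\<close>.\<close>

lemma freshmans_dream_mod: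
  fixes p :: nat
  assumes x: "x \<in> carrier R" and y: "y \<in> carrier R" and p: "Factorial_Ring.prime p"
  shows "(x \<oplus> y) [^] p \<ominus> (x [^] p \<oplus> y [^] p) \<in> multiples p"
proof -
  interpret ideal "multiples p" R
    by (rule multiples_ideal)
  define g where "g k = [(p choose k)] \<cdot> (x [^] k \<otimes> y [^] (p - k))" for k
  have g: "g k \<in> carrier R" for k
    using x y by (simp add: g_def)
  have p0: "p \<noteq> 0"
    using p by auto
  define C where "C = {..p} - {0, p}"
  have "(x \<oplus> y) [^] p = finsum R g ({0, p} \<union> C)"
    using binomial[OF x y, of p] by (simp add: g_def [abs_def] C_def insert_absorb)
  also have "\<dots> = finsum R g {0, p} \<oplus> finsum R g C"
    by (rule finsum_Un_disjoint) (auto simp: C_def g)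
  also have "finsum R g {0, p} = x [^] p \<oplus> y [^] p"
    using p0 g x y by (simp add: finsum_insert g_def a_comm)
  finally have pow: "(x \<oplus> y) [^] p = (x [^] p \<oplus> y [^] p) \<oplus> finsum R g C" .
  have cancel: "(d \<oplus> c) \<ominus> d = c" if "c \<in> carrier R" "d \<in> carrier R" for c d
    using that by (simp add: a_minus_def a_ac r_neg r_neg1 r_neg2)
  have "(x \<oplus> y) [^] p \<ominus> (x [^] p \<oplus> y [^] p) = finsum R g C"
    unfolding pow by (rule cancel) (use x y g in \<open>auto intro!: finsum_closed\<close>)
  also have "\<dots> \<in> multiples p"
  proof (rule finsum_mem)
    fix k assume "k \<in> C"
    then have "p dvd (p choose k)"
      using p p0 by (intro dvd_choose_prime) (auto simp: C_def)
    then show "g k \<in> multiples p"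
      using x y unfolding g_def by (intro dvd_imp_mem_multiples) auto
  qed
  finally show ?thesis .
qed

text \<open>Induction on \<open>e\<close>: take the \<open>p\<close>-th power of the congruence for
  \<open>e\<close>, then apply the case of exponent \<open>p\<close> to \<open>x^(p^e)\<close> and
  \<open>y^(p^e)\<close>.\<close>

lemma freshmans_dream_mod':
  fixes p :: nat
  assumes x: "x \<in> carrier R" and y: "y \<in> carrier R" and p: "Factorial_Ring.prime p"
  shows "(x \<oplus> y) [^] (p ^ e) \<ominus> (x [^] (p ^ e) \<oplus> y [^] (p ^ e)) \<in> multiples p"
proof -
  interpret ideal "multiples p" R
    by (rule multiples_ideal)
  show ?thesis
  proof (induction e)
    case 0
    show ?case
      using x y by (simp add: a_minus_def r_neg)
  next
    case (Suc e)
    let ?a = "x [^] (p ^ e)" and ?b = "y [^] (p ^ e)"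
    have "((x \<oplus> y) [^] (p ^ e)) [^] p \<ominus> (?a \<oplus> ?b) [^] p \<in> multiples p"
      using x y Suc by (intro pow_minus_pow_mem) auto
    moreover have "(?a \<oplus> ?b) [^] p \<ominus> (?a [^] p \<oplus> ?b [^] p) \<in> multiples p"
      using x y p by (intro freshmans_dream_mod) auto
    ultimately have "((x \<oplus> y) [^] (p ^ e)) [^] p \<ominus> (?a [^] p \<oplus> ?b [^] p) \<in> multiples p"
      by (rule minus_mem_trans[rotated 3]) (use x y in auto)
    then show ?case
      using x y by (simp add: nat_pow_pow mult.commute)
  qed
qed

section \<open>The alternating sum over all index sets\<close>

lemma alternating_sum_mem_multiples:
  fixes p e :: "'i \<Rightarrow> nat"
  assumes "finite A" "x \<in> carrier R" "y \<in> carrier R"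
    and p: "\<And>i. i \<in> A \<Longrightarrow> Factorial_Ring.prime (p i)" "inj_on p A"
  shows "(\<Oplus>I\<in>Pow A. [((-1 :: int) ^ card I)] \<cdot>
      ((x [^] (\<Prod>i\<in>I. p i ^ e i) \<oplus> y [^] (\<Prod>i\<in>I. p i ^ e i))
        [^] (\<Prod>j\<in>A - I. p j ^ e j))) \<in> multiples (\<Prod>i\<in>A. p i)"
proof (rule multiples_prod)
  fix k assume k: "k \<in> A"
  interpret ideal "multiples (p k)" R
    by (rule multiples_ideal)
  show "(\<Oplus>I\<in>Pow A. [((-1 :: int) ^ card I)] \<cdot>
      ((x [^] (\<Prod>i\<in>I. p i ^ e i) \<oplus> y [^] (\<Prod>i\<in>I. p i ^ e i))
        [^] (\<Prod>j\<in>A - I. p j ^ e j))) \<in> multiples (p k)"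
  proof (rule alternating_sum_mem[OF assms(1) k])
    fix S assume S: "S \<subseteq> A - {k}"
    let ?n = "\<Prod>i\<in>S. p i ^ e i" and ?q = "p k ^ e k"
    let ?m = "\<Prod>j\<in>A - insert k S. p j ^ e j"
    have S': "finite S" "k \<notin> S"
      using S finite_subset[OF S] assms(1) by auto
    have eq: "A - S = insert k (A - insert k S)"
      using S k by blast
    \<comment> \<open>Passing from \<open>S\<close> to \<open>insert k S\<close> moves the factor
      \<open>?q\<close> from the outer exponent to the inner one, while \<open>?m\<close> stays
      outside. The Frobenius congruence for \<open>?q\<close>, raised to the power
      \<open>?m\<close>, compares the two.\<close>
    have 1: "(\<Prod>j\<in>A - S. p j ^ e j) = ?q * ?m"
      unfolding eq using assms(1) by (intro prod.insert) auto
    have 2: "(\<Prod>i\<in>insert k S. p i ^ e i) = ?n * ?q"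
      using S' by simp
    have "(x [^] ?n \<oplus> y [^] ?n) [^] ?q \<ominus> ((x [^] ?n) [^] ?q \<oplus> (y [^] ?n) [^] ?q)
        \<in> multiples (p k)"
      using assms(2,3) p(1)[OF k] by (intro freshmans_dream_mod') auto
    then have "((x [^] ?n \<oplus> y [^] ?n) [^] ?q) [^] ?m
        \<ominus> ((x [^] ?n) [^] ?q \<oplus> (y [^] ?n) [^] ?q) [^] ?m \<in> multiples (p k)"
      using assms(2,3) by (intro pow_minus_pow_mem) auto
    then show "(x [^] ?n \<oplus> y [^] ?n) [^] (\<Prod>j\<in>A - S. p j ^ e j)
        \<ominus> (x [^] (\<Prod>i\<in>insert k S. p i ^ e i) \<oplus> y [^] (\<Prod>i\<in>insert k S. p i ^ e i)) [^] ?m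
        \<in> multiples (p k)"
      unfolding 1 2 using assms(2,3) by (simp add: nat_pow_pow)
  qed (use assms(2,3) in auto)
next
  show "coprime (p i) (p j)" if "i \<in> A" "j \<in> A" "i \<noteq> j" for i j
    using that p by (intro primes_coprime) (auto simp: inj_on_def)
qed (use assms(1-3) in \<open>auto intro!: finsum_closed\<close>)

text \<open>Connects the double sum of the theorem, grouped by cardinality, with a single sum over
  nonempty index sets.\<close>

lemma finsum_by_card:
  assumes "finite A" "\<And>S. S \<subseteq> A \<Longrightarrow> G S \<in> carrier R"
  shows "(\<Oplus>s\<in>{1..card A}. \<Oplus>S\<in>{S. S \<subseteq> A \<and> card S = s}. G S) = finsum R G (Pow A - {{}})"
proof -
  have "(\<Union>s\<in>{1..card A}. {S. S \<subseteq> A \<and> card S = s}) = Pow A - {{}}"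
    using assms(1) by (auto simp: card_mono Suc_le_eq card_gt_0_iff finite_subset)
  then show ?thesis
    using assms
    by (subst add.finprod_UN_disjoint [symmetric]) (auto simp: pairwise_def disjnt_def)
qed

end

theorem theorem4p2:
  fixes R :: "('a, 'm) ring_scheme" (structure)
    and N l :: nat
    and p e :: "nat \<Rightarrow> nat"
    and x y :: 'a
  assumes "cring R"
    and "l \<ge> 1"
    and "\<And>i. i \<in> {1..l} \<Longrightarrow> Factorial_Ring.prime (p i)"
    and "inj_on p {1..l}"
    and "\<And>i. i \<in> {1..l} \<Longrightarrow> e i \<ge> 1"
    and "N = (\<Prod>i\<in>{1..l}. p i ^ e i)"
    and "x \<in> carrier R"
    and "y \<in> carrier R"
  shows "cong_mod_multiples R (\<Prod>i\<in>{1..l}. p i)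
    ((x \<oplus> y) [^] N)
    (\<Oplus>s\<in>{1..l}. \<Oplus>I\<in>{I. I \<subseteq> {1..l} \<and> card I = s}.
       [((-1 :: int) ^ (s + 1))] \<cdot>
         ((x [^] (\<Prod>i\<in>I. p i ^ e i) \<oplus> y [^] (\<Prod>i\<in>I. p i ^ e i))
            [^] (\<Prod>j\<in>{1..l} - I. p j ^ e j)))"
proof -
  interpret cring R by fact
  define A where "A = {1..l}"
  define F where "F I = (x [^] (\<Prod>i\<in>I. p i ^ e i) \<oplus> y [^] (\<Prod>i\<in>I. p i ^ e i))
            [^] (\<Prod>j\<in>A - I. p j ^ e j)" for I
  have A: "finite A" "card A = l"
    by (simp_all add: A_def)
  have F [simp]: "F I \<in> carrier R" for I
    using assms by (simp add: F_def)
  define P where "P = Pow A - {{}}"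
  \<comment> \<open>\<open>U\<close> is the right-hand side of the theorem as one sum;
    \<open>V\<close> has the signs of the alternating sum and equals
    \<open>\<ominus> U\<close>.\<close>
  define U where "U = (\<Oplus>I\<in>P. [((-1 :: int) ^ (card I + 1))] \<cdot> F I)"
  define V where "V = (\<Oplus>I\<in>P. [((-1 :: int) ^ card I)] \<cdot> F I)"
  have UV: "U \<in> carrier R" "V \<in> carrier R"
    by (auto simp: U_def V_def)
  have "V \<oplus> U = (\<Oplus>I\<in>P. [((-1 :: int) ^ card I)] \<cdot> F I \<oplus> [((-1 :: int) ^ (card I + 1))] \<cdot> F I)"
    unfolding U_def V_def by (intro finsum_addf [symmetric]) auto
  also have "\<dots> = \<zero>"
    by (intro add.finprod_one_eqI) (simp add: add.int_pow_mult [symmetric] add_pow_int_ge [of 0])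
  finally have V: "V = \<ominus> U"
    using UV by (simp add: minus_equality)
  \<comment> \<open>The empty index set has sign \<open>1\<close> and supplies the left-hand side
    \<open>(x + y)^N\<close>, its inner exponent being an empty product.\<close>
  have "F {} \<oplus> V = (\<Oplus>I\<in>insert {} P. [((-1 :: int) ^ card I)] \<cdot> F I)"
    unfolding V_def using A by (subst finsum_insert) (auto simp: P_def)
  also have "insert {} P = Pow A"
    by (auto simp: P_def)
  also have "(\<Oplus>I\<in>Pow A. [((-1 :: int) ^ card I)] \<cdot> F I) \<in> multiples (\<Prod>i\<in>A. p i)"
    unfolding F_def using assms by (intro alternating_sum_mem_multiples) (auto simp: A_def)
  finally have "F {} \<ominus> U \<in> multiples (\<Prod>i\<in>A. p i)"
    by (simp add: a_minus_def V)
  moreover have "F {} = (x \<oplus> y) [^] N"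
    using assms by (simp add: F_def A_def)
  moreover have "U = (\<Oplus>s\<in>{1..l}. \<Oplus>I\<in>{I. I \<subseteq> A \<and> card I = s}. [((-1 :: int) ^ (card I + 1))] \<cdot> F I)"
    unfolding U_def P_def using A finsum_by_card[of A] by simp
  moreover have "\<dots> = (\<Oplus>s\<in>{1..l}. \<Oplus>I\<in>{I. I \<subseteq> A \<and> card I = s}. [((-1 :: int) ^ (s + 1))] \<cdot> F I)"
    by (intro finsum_cong' refl) auto
  ultimately show ?thesis
    unfolding cong_mod_multiples_def multiples_def F_def A_def by simp
qed

end
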